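(* Let $f:\mathbb{R}^n\to\mathbb{R}$ be convex, twice continuously differentiable, coercive, and strongly convex on bounded subsets of $\mathbb{R}^n$. Let $\beta>0$, $x_0,\dot x_0\in\mathbb{R}^n$. Let $\alpha:[0,+\infty)\to\mathbb{R}$ be non-increasing, non-negative and differentiable, with $\alpha(0)=\alpha_0$, and let $\varepsilon:[0,+\infty)\to\mathbb{R}$ be non-increasing, positive, and twice differentiable with bounded second derivative, with $\varepsilon(0)=\varepsilon_0$, $\varepsilon'(0)=\varepsilon_0'$. Define $\nu(t)=\alpha(t)-\varepsilon'(t)-\frac1\beta\varepsilon(t)$ for $t\ge0$. Then the second-order problem $$\varepsilon(t)\ddot x(t)+\alpha(t)\dot x(t)+\beta\nabla^2 f(x(t))\dot x(t)+\nabla f(x(t))=0,\quad t\ge 0,\qquad (x(0),\dot x(0))=(x_0,\dot x_0),$$ is equivalent to the first-order system $$\begin{cases}\varepsilon(t)\dot x(t)+\beta\nabla f(x(t))+\nu(t)x(t)+y(t)=0\\ \dot y(t)+\nu'(t)x(t)+\frac{\nu(t)}{\beta}x(t)+\frac1\beta y(t)=0\end{cases}\qquad t\ge0,$$ with initial conditions $(x(0),y(0))=\left(x_0,\,-\varepsilon_0\dot x_0-\beta\nabla f(x_0)-(\alpha_0-\varepsilon_0'-\tfrac1\beta\varepsilon_0)x_0\right)$; that is, a function $x:[0,+\infty)\to\mathbb{R}^n$ is a (twice differentiable) solution of the second-order problem if and only if there is $y:[0,+\infty)\to\mathbb{R}^n$ such that $(x,y)$ is a (differentiable) solution of the first-order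 system with these initial conditions.
   Context: $\mathbb{R}^n$ is equipped with a scalar product $\langle\cdot,\cdot\rangle$ and the induced norm $\|\cdot\|$. Coercive means $f(y)\to+\infty$ as $\|y\|\to+\infty$. Strongly convex on bounded subsets means that for every bounded set $K\subset\mathbb{R}^n$ there is $\mu_K>0$ such that $\langle\nabla f(y_1)-\nabla f(y_2),y_1-y_2\rangle\ge\mu_K\|y_1-y_2\|^2$ for all $y_1,y_2\in K$. Dots denote time derivatives (one-sided at $t=0$). *)

theory Defs
  imports "HOL-Analysis.Analysis"
begin

definition gradient :: "('a::euclidean_space \<Rightarrow> real) \<Rightarrow> 'a \<Rightarrow> 'a" where
  "gradient f x = (THE g. GDERIV f x :> g)"

text \<open>The Hessian as a linear operator: the Frechet derivative of the gradient.\<close>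

definition hessian :: "('a::euclidean_space \<Rightarrow> real) \<Rightarrow> 'a \<Rightarrow> 'a \<Rightarrow> 'a" where
  "hessian f x = frechet_derivative (gradient f) (at x)"

text \<open>The last clause is continuity of the Hessian in operator norm.\<close>

definition twice_continuously_differentiable :: "('a::euclidean_space \<Rightarrow> real) \<Rightarrow> bool" where
  "twice_continuously_differentiable f \<longleftrightarrow>
     (\<forall>x. f differentiable (at x)) \<and>
     (\<forall>x. gradient f differentiable (at x)) \<and>
     continuous_on UNIV (\<lambda>x. Blinfun (hessian f x))"

definition coercive :: "('a::euclidean_space \<Rightarrow> real) \<Rightarrow> bool" where
  "coercive f \<longleftrightarrow> filterlim f at_top at_infinity"

definition strongly_convex_on_bounded_sets :: "('a::euclidean_space \<Rightarrow> real) \<Rightarrow> bool" where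
  "strongly_convex_on_bounded_sets f \<longleftrightarrow>
     (\<forall>K. bounded K \<longrightarrow> (\<exists>\<mu>>0. \<forall>y1\<in>K. \<forall>y2\<in>K.
        inner (gradient f y1 - gradient f y2) (y1 - y2) \<ge> \<mu> * (norm (y1 - y2))\<^sup>2))"

text \<open>Functions on \<open>[0, \<infinity>)\<close> are total functions on the reals of which only the
  values at \<open>t \<ge> 0\<close> matter; derivatives are taken within \<open>{0..}\<close>, so they are
  one-sided at \<open>0\<close> and two-sided at \<open>t > 0\<close>.\<close>

definition time_deriv :: "(real \<Rightarrow> 'b::real_normed_vector) \<Rightarrow> real \<Rightarrow> 'b" where
  "time_deriv x t = vector_derivative x (at t within {0..})"

definition twice_differentiable_in_time :: "(real \<Rightarrow> 'b::real_normed_vector) \<Rightarrow> bool" where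
  "twice_differentiable_in_time x \<longleftrightarrow>
     x differentiable_on {0..} \<and> time_deriv x differentiable_on {0..}"

definition solves_second_order ::
  "('a::euclidean_space \<Rightarrow> real) \<Rightarrow> (real \<Rightarrow> real) \<Rightarrow> (real \<Rightarrow> real) \<Rightarrow> real \<Rightarrow> 'a \<Rightarrow> 'a
     \<Rightarrow> (real \<Rightarrow> 'a) \<Rightarrow> bool" where
  "solves_second_order f \<epsilon> \<alpha> \<beta> x\<^sub>0 v\<^sub>0 x \<longleftrightarrow>
     twice_differentiable_in_time x \<and>
     (\<forall>t\<ge>0. \<epsilon> t *\<^sub>R time_deriv (time_deriv x) t + \<alpha> t *\<^sub>R time_deriv x t
        + \<beta> *\<^sub>R hessian f (x t) (time_deriv x t) + gradient f (x t) = 0) \<and>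
     x 0 = x\<^sub>0 \<and> time_deriv x 0 = v\<^sub>0"

definition solves_first_order ::
  "('a::euclidean_space \<Rightarrow> real) \<Rightarrow> (real \<Rightarrow> real) \<Rightarrow> (real \<Rightarrow> real) \<Rightarrow> real \<Rightarrow> 'a \<Rightarrow> 'a
     \<Rightarrow> (real \<Rightarrow> 'a) \<Rightarrow> (real \<Rightarrow> 'a) \<Rightarrow> bool" where
  "solves_first_order f \<epsilon> \<nu> \<beta> x\<^sub>0 y\<^sub>0 x y \<longleftrightarrow>
     x differentiable_on {0..} \<and> y differentiable_on {0..} \<and>
     (\<forall>t\<ge>0. \<epsilon> t *\<^sub>R time_deriv x t + \<beta> *\<^sub>R gradient f (x t) + \<nu> t *\<^sub>R x t + y t = 0 \<and>
        time_deriv y t + time_deriv \<nu> t *\<^sub>R x t + (\<nu> t / \<beta>) *\<^sub>R x t + (1 / \<beta>) *\<^sub>R y t = 0) \<and>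
     x 0 = x\<^sub>0 \<and> y 0 = y\<^sub>0"

end

(* The first equation of the system determines y = - \<epsilon> x' - \<beta> \<nabla>f(x) - \<nu> x. Differentiating this y,
   the left-hand side of the second equation becomes the negative of that of the second-order
   equation: the coefficient of x' is \<nu> + \<epsilon>' + \<epsilon> / \<beta> = \<alpha>. Conversely, since \<epsilon> > 0, the first
   equation expresses x' by differentiable functions, so x is twice differentiable. *)
theory Submission
  imports Defs
begin

text \<open>Uniqueness of the derivative needs a nontrivial filter: at 0 it is the right-sided one,
  at \<open>t > 0\<close> the full neighbourhood filter.\<close>

lemma time_deriv_eqI:
  assumes "(x has_vector_derivative d) (at t within {0..})" and "t \<ge> 0"
  shows "time_deriv x t = d"
proof -
  have "at t within {0..} \<noteq> bot"
  proof (cases "t = 0")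
    case True
    then show ?thesis
      by (simp add: at_within_Ici_at_right)
  next
    case False
    then have "t \<in> interior {0..}"
      using assms(2) by simp
    then have "at t within {0..} = at t"
      by (rule at_within_interior)
    then show ?thesis
      by simp
  qed
  then show ?thesis
    unfolding time_deriv_def using assms(1) by (rule vector_derivative_within)
qed

lemma has_time_deriv:
  assumes "x differentiable_on {0..}" and "t \<ge> 0"
  shows "(x has_vector_derivative time_deriv x t) (at t within {0..})"
  using assms unfolding time_deriv_def differentiable_on_def
  by (simp add: vector_derivative_works)

text \<open>Serves for \<open>\<nu>\<close> and for \<open>time_deriv x\<close>, whose formulas are
  known only for \<open>t \<ge> 0\<close>. Differentiability within \<open>S\<close> sees only
  values on \<open>S\<close>, so any radius, here 1, will do.\<close>

lemma differentiable_on_transform: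
  assumes "f differentiable_on S" and "\<And>x. x \<in> S \<Longrightarrow> f x = g x"
  shows "g differentiable_on S"
  unfolding differentiable_on_def
proof
  fix x assume "x \<in> S"
  with assms show "g differentiable at x within S"
    by (intro differentiable_transform_within[of f x S 1 g]) (auto simp: differentiable_on_def)
qed

lemma gradient_comp_has_vector_derivative:
  assumes "gradient f differentiable (at (x t))"
    and "(x has_vector_derivative v) (at t within S)"
  shows "((\<lambda>t. gradient f (x t)) has_vector_derivative hessian f (x t) v) (at t within S)"
proof -
  have H: "(gradient f has_derivative hessian f (x t)) (at (x t))"
    using assms(1) unfolding hessian_def by (simp add: frechet_derivative_works)
  \<comment> \<open>The chain rule for a one-sided curve asks for the outer derivative only along
    the image of the curve.\<close>
  then have "(gradient f has_derivative hessian f (x t)) (at (x t) within x ` S)"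
    by (rule has_derivative_at_withinI)
  from vector_derivative_diff_chain_within[OF assms(2) this]
  show ?thesis
    by (simp add: o_def)
qed

text \<open>An identity between the two left-hand sides, using neither equation as a hypothesis, so
  that it serves both directions of the equivalence. The terms in \<open>x t\<close> cancel, and
  \<open>(1 / \<beta>) *\<^sub>R y t\<close> supplies the undifferentiated gradient.\<close>

lemma second_equation_eq_neg_second_order:
  fixes x y :: "real \<Rightarrow> 'a::euclidean_space" and \<alpha> \<epsilon> \<nu> :: "real \<Rightarrow> real"
  assumes grad: "\<And>z. gradient f differentiable (at z)"
    and x: "x differentiable_on {0..}" and v: "time_deriv x differentiable_on {0..}"
    and \<epsilon>: "\<epsilon> differentiable_on {0..}" and \<nu>: "\<nu> differentiable_on {0..}"
    and "\<beta> \<noteq> 0" and t: "t \<ge> 0"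
    and \<nu>_eq: "\<nu> t = \<alpha> t - time_deriv \<epsilon> t - (1 / \<beta>) * \<epsilon> t"
    and y_eq: "\<And>s. s \<ge> 0 \<Longrightarrow>
      y s = - (\<epsilon> s *\<^sub>R time_deriv x s + \<beta> *\<^sub>R gradient f (x s) + \<nu> s *\<^sub>R x s)"
  shows "time_deriv y t + time_deriv \<nu> t *\<^sub>R x t + (\<nu> t / \<beta>) *\<^sub>R x t + (1 / \<beta>) *\<^sub>R y t
    = - (\<epsilon> t *\<^sub>R time_deriv (time_deriv x) t + \<alpha> t *\<^sub>R time_deriv x t
        + \<beta> *\<^sub>R hessian f (x t) (time_deriv x t) + gradient f (x t))"
proof -
  note d = has_time_deriv[OF _ t]
  \<comment> \<open>The product rule for \<open>*\<^sub>R\<close> expects the derivative of the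
    scalar factor as a real derivative.\<close>
  note real_d = d[OF \<epsilon>, folded has_real_derivative_iff_has_vector_derivative]
    d[OF \<nu>, folded has_real_derivative_iff_has_vector_derivative]
  have "((\<lambda>s. - (\<epsilon> s *\<^sub>R time_deriv x s + \<beta> *\<^sub>R gradient f (x s) + \<nu> s *\<^sub>R x s))
    has_vector_derivative
      - ((\<epsilon> t *\<^sub>R time_deriv (time_deriv x) t + time_deriv \<epsilon> t *\<^sub>R time_deriv x t)
        + \<beta> *\<^sub>R hessian f (x t) (time_deriv x t)
        + (\<nu> t *\<^sub>R time_deriv x t + time_deriv \<nu> t *\<^sub>R x t))) (at t within {0..})"
    by (intro has_vector_derivative_minus has_vector_derivative_add
        has_vector_derivative_scaleR bounded_linear.has_vector_derivative[OF bounded_linear_scaleR_right]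
        gradient_comp_has_vector_derivative grad d x v real_d)
  then have "(y has_vector_derivative
      - ((\<epsilon> t *\<^sub>R time_deriv (time_deriv x) t + time_deriv \<epsilon> t *\<^sub>R time_deriv x t)
        + \<beta> *\<^sub>R hessian f (x t) (time_deriv x t)
        + (\<nu> t *\<^sub>R time_deriv x t + time_deriv \<nu> t *\<^sub>R x t))) (at t within {0..})"
    \<comment> \<open>Agreement on \<open>{0..}\<close> suffices, since the derivative is taken
      within that set.\<close>
    by (rule has_vector_derivative_transform[rotated 2]) (use t y_eq in auto)
  note dy = time_deriv_eqI[OF this t]
  have "\<alpha> t = \<nu> t + time_deriv \<epsilon> t + \<epsilon> t / \<beta>"
    using \<nu>_eq by simp
  then show ?thesis
    using \<open>\<beta> \<noteq> 0\<close> unfolding dy y_eq[OF t] by (simp add: algebra_simps)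
qed

theorem mainTheorem2:
  fixes f :: "'a::euclidean_space \<Rightarrow> real"
    and \<alpha> \<epsilon> \<nu> :: "real \<Rightarrow> real"
    and \<beta> \<alpha>\<^sub>0 \<epsilon>\<^sub>0 \<epsilon>\<^sub>0' :: real
    and x\<^sub>0 v\<^sub>0 :: 'a
  assumes f_convex: "convex_on UNIV f"
    and f_C2: "twice_continuously_differentiable f"
    and f_coercive: "coercive f"
    and f_strongly_convex: "strongly_convex_on_bounded_sets f"
    and beta_pos: "\<beta> > 0"
    and alpha_nonincreasing: "antimono_on {0..} \<alpha>"
    and alpha_nonneg: "\<And>t. t \<ge> 0 \<Longrightarrow> \<alpha> t \<ge> 0"
    and alpha_differentiable: "\<alpha> differentiable_on {0..}"
    and alpha_0: "\<alpha> 0 = \<alpha>\<^sub>0"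
    and eps_nonincreasing: "antimono_on {0..} \<epsilon>"
    and eps_pos: "\<And>t. t \<ge> 0 \<Longrightarrow> \<epsilon> t > 0"
    and eps_twice_differentiable: "twice_differentiable_in_time \<epsilon>"
    and eps_second_deriv_bounded: "bounded (time_deriv (time_deriv \<epsilon>) ` {0..})"
    and eps_0: "\<epsilon> 0 = \<epsilon>\<^sub>0"
    and eps_deriv_0: "time_deriv \<epsilon> 0 = \<epsilon>\<^sub>0'"
    and nu_eq: "\<And>t. t \<ge> 0 \<Longrightarrow> \<nu> t = \<alpha> t - time_deriv \<epsilon> t - (1 / \<beta>) * \<epsilon> t"
  shows "\<forall>x :: real \<Rightarrow> 'a.
    solves_second_order f \<epsilon> \<alpha> \<beta> x\<^sub>0 v\<^sub>0 x \<longleftrightarrow>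
    (\<exists>y. solves_first_order f \<epsilon> \<nu> \<beta> x\<^sub>0
       (- \<epsilon>\<^sub>0 *\<^sub>R v\<^sub>0 - \<beta> *\<^sub>R gradient f x\<^sub>0 - (\<alpha>\<^sub>0 - \<epsilon>\<^sub>0' - (1 / \<beta>) * \<epsilon>\<^sub>0) *\<^sub>R x\<^sub>0) x y)"
proof (intro allI iffI)
  let ?y\<^sub>0 = "- \<epsilon>\<^sub>0 *\<^sub>R v\<^sub>0 - \<beta> *\<^sub>R gradient f x\<^sub>0 - (\<alpha>\<^sub>0 - \<epsilon>\<^sub>0' - (1 / \<beta>) * \<epsilon>\<^sub>0) *\<^sub>R x\<^sub>0"
  have grad: "gradient f differentiable (at z)" for z
    using f_C2 by (simp add: twice_continuously_differentiable_def)
  have \<epsilon>: "\<epsilon> differentiable_on {0..}" and \<epsilon>': "time_deriv \<epsilon> differentiable_on {0..}"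
    using eps_twice_differentiable by (auto simp: twice_differentiable_in_time_def)
  \<comment> \<open>The second derivative of \<open>\<epsilon>\<close> enters here:
    \<open>\<nu>\<close> contains the first one, and the system contains the derivative of
    \<open>\<nu>\<close>.\<close>
  have "(\<lambda>t. \<alpha> t - time_deriv \<epsilon> t - (1 / \<beta>) * \<epsilon> t) differentiable_on {0..}"
    by (intro derivative_intros alpha_differentiable \<epsilon> \<epsilon>')
  then have \<nu>: "\<nu> differentiable_on {0..}"
    by (rule differentiable_on_transform) (simp add: nu_eq)
  have \<nu>_0: "\<nu> 0 = \<alpha>\<^sub>0 - \<epsilon>\<^sub>0' - (1 / \<beta>) * \<epsilon>\<^sub>0"
    using nu_eq[of 0] by (simp add: alpha_0 eps_0 eps_deriv_0)
  have grad_comp: "(\<lambda>t. gradient f (x t)) differentiable_on {0..}"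
    if "x differentiable_on {0..}" for x :: "real \<Rightarrow> 'a"
    using gradient_comp_has_vector_derivative[OF grad has_time_deriv[OF that]]
    by (auto simp: differentiable_on_def intro: differentiableI_vector)
  have "\<beta> \<noteq> 0"
    using beta_pos by simp
  \<comment> \<open>The premise \<open>t \<ge> 0\<close> remains twice, once from the lemma and once
    from \<open>nu_eq\<close>; hence the doubled \<open>that\<close> in later uses.\<close>
  note key = second_equation_eq_neg_second_order[where \<alpha> = \<alpha> and \<epsilon> = \<epsilon> and \<nu> = \<nu>,
      OF grad _ _ \<epsilon> \<nu> \<open>\<beta> \<noteq> 0\<close> _ nu_eq]
  {
    fix x assume "solves_second_order f \<epsilon> \<alpha> \<beta> x\<^sub>0 v\<^sub>0 x"
    then have x: "x differentiable_on {0..}" and v: "time_deriv x differentiable_on {0..}"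
      and ode: "\<And>t. t \<ge> 0 \<Longrightarrow> \<epsilon> t *\<^sub>R time_deriv (time_deriv x) t + \<alpha> t *\<^sub>R time_deriv x t
        + \<beta> *\<^sub>R hessian f (x t) (time_deriv x t) + gradient f (x t) = 0"
      and init: "x 0 = x\<^sub>0" "time_deriv x 0 = v\<^sub>0"
      by (auto simp: solves_second_order_def twice_differentiable_in_time_def)
    define y where
      "y = (\<lambda>s. - (\<epsilon> s *\<^sub>R time_deriv x s + \<beta> *\<^sub>R gradient f (x s) + \<nu> s *\<^sub>R x s))"
    have "y differentiable_on {0..}"
      unfolding y_def by (intro derivative_intros grad_comp x v \<epsilon> \<nu>)
    moreover have "time_deriv y t + time_deriv \<nu> t *\<^sub>R x t + (\<nu> t / \<beta>) *\<^sub>R x t + (1 / \<beta>) *\<^sub>R y t = 0"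
      if "t \<ge> 0" for t
      using key[where t = t, OF x v that that, where y = y] ode[OF that] by (simp add: y_def)
    moreover have "y 0 = ?y\<^sub>0"
      by (simp add: y_def init eps_0 \<nu>_0)
    ultimately have "solves_first_order f \<epsilon> \<nu> \<beta> x\<^sub>0 ?y\<^sub>0 x y"
      using x init(1) by (simp add: solves_first_order_def y_def)
    then show "\<exists>y. solves_first_order f \<epsilon> \<nu> \<beta> x\<^sub>0 ?y\<^sub>0 x y"
      by blast
  next
    fix x assume "\<exists>y. solves_first_order f \<epsilon> \<nu> \<beta> x\<^sub>0 ?y\<^sub>0 x y"
    then obtain y where x: "x differentiable_on {0..}" and y: "y differentiable_on {0..}"
      and eq1: "\<And>t. t \<ge> 0 \<Longrightarrow>
        \<epsilon> t *\<^sub>R time_deriv x t + \<beta> *\<^sub>R gradient f (x t) + \<nu> t *\<^sub>R x t + y t = 0"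
      and eq2: "\<And>t. t \<ge> 0 \<Longrightarrow>
        time_deriv y t + time_deriv \<nu> t *\<^sub>R x t + (\<nu> t / \<beta>) *\<^sub>R x t + (1 / \<beta>) *\<^sub>R y t = 0"
      and init: "x 0 = x\<^sub>0" "y 0 = ?y\<^sub>0"
      by (auto simp: solves_first_order_def)
    have y_eq: "y t = - (\<epsilon> t *\<^sub>R time_deriv x t + \<beta> *\<^sub>R gradient f (x t) + \<nu> t *\<^sub>R x t)"
      if "t \<ge> 0" for t
      using eq1[OF that] by (simp add: add_eq_0_iff)
    \<comment> \<open>The first equation solved for x'. Here the differentiability of
      \<open>y\<close> is given, and that of x' is deduced from it; the inverse is differentiable
      because \<open>\<epsilon>\<close> has no zero on \<open>{0..}\<close>.\<close>
    have "(\<lambda>t. inverse (\<epsilon> t) *\<^sub>R - (\<beta> *\<^sub>R gradient f (x t) + \<nu> t *\<^sub>R x t + y t))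
        differentiable_on {0..}"
      by (intro derivative_intros grad_comp x y \<epsilon> \<nu>) (use eps_pos in force)
    then have v: "time_deriv x differentiable_on {0..}"
    proof (rule differentiable_on_transform)
      fix t :: real assume "t \<in> {0..}"
      then show "inverse (\<epsilon> t) *\<^sub>R - (\<beta> *\<^sub>R gradient f (x t) + \<nu> t *\<^sub>R x t + y t) = time_deriv x t"
        using eps_pos[of t] by (simp add: y_eq)
    qed
    have "\<epsilon> t *\<^sub>R time_deriv (time_deriv x) t + \<alpha> t *\<^sub>R time_deriv x t
        + \<beta> *\<^sub>R hessian f (x t) (time_deriv x t) + gradient f (x t) = 0" if "t \<ge> 0" for t
      using key[where t = t, OF x v that that y_eq] eq2[OF that]
      by (simp only: neg_0_equal_iff_equal)
    moreover have "time_deriv x 0 = v\<^sub>0"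
    proof -
      \<comment> \<open>The coefficient of \<open>x\<^sub>0\<close> in the prescribed
        \<open>y 0\<close> is minus \<open>\<nu> 0\<close>, so at time 0 the gradient and position
        terms of the first equation cancel.\<close>
      have "\<epsilon>\<^sub>0 *\<^sub>R time_deriv x 0 = \<epsilon>\<^sub>0 *\<^sub>R v\<^sub>0"
        using eq1[of 0] by (simp add: init eps_0 \<nu>_0)
      then show ?thesis
        using eps_pos[of 0] by (simp add: eps_0)
    qed
    ultimately show "solves_second_order f \<epsilon> \<alpha> \<beta> x\<^sub>0 v\<^sub>0 x"
      using x v init(1) by (simp add: solves_second_order_def twice_differentiable_in_time_def)
  }
qed

end
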